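(* Let $p\in\mathbb{N}$, let $\eta,\mu\in\mathbb{C}$ with $(\eta,\mu)\neq(0,0)$, let $\sigma\in\mathbb{C}$ and $\gamma\in\mathbb{C}\setminus\{0\}$. Let $q$ be univalent in $\mathbb{U}$ with $q(0)=1$ and suppose $$\operatorname{Re}\left\{1+\frac{zq''(z)}{q'(z)}\right\}>\max\left\{0,-\operatorname{Re}\left(\frac{\sigma}{\gamma}\right)\right\}\qquad(z\in\mathbb{U}).$$ Let $f\in\mathcal{A}_0$ and let $$\Psi(z)=\left[\frac{f'(z)}{pz^{p-1}}\right]^{\eta}\left[\frac{z^p}{f(z)}\right]^{\mu}\left\{\sigma+\gamma\left[\eta\left(1-p+\frac{zf''(z)}{f'(z)}\right)+\mu\left(p-\frac{zf'(z)}{f(z)}\right)\right]\right\}.$$ If $$\Psi(z)\prec\sigma q(z)+\gamma zq'(z)\qquad(z\in\mathbb{U}),\qquad(\ast)$$ then $\mathscr{F}_p^{\eta,\mu}[f](z)\prec q(z)$, and $q$ is the best dominant of the differential subordination $(\ast)$.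
   Context: $\mathbb{U}=\{z\in\mathbb{C}:|z|<1\}$. $\mathcal{A}_p$ is the class of analytic functions on $\mathbb{U}$ of the form $f(z)=z^p+\sum_{k=p+1}^\infty a_kz^k$. For $g,h$ analytic in $\mathbb{U}$, $g\prec h$ ($g$ is subordinate to $h$) means $g=h\circ\omega$ for some analytic $\omega:\mathbb{U}\to\mathbb{U}$ with $\omega(0)=0$. For $f\in\mathcal{A}_p$, $\mathscr{F}_p^{\eta,\mu}[f](z)=\left[\frac{f'(z)}{pz^{p-1}}\right]^{\eta}\left[\frac{z^p}{f(z)}\right]^{\mu}$, where all powers are principal, i.e. the analytic branches with value $1$ at $z=0$ (the bases being given the value $1$ at $z=0$ by removing the singularity). $\mathcal{A}_0$ is the set of $f\in\mathcal{A}_p$ for which $\mathscr{F}_p^{\eta,\mu}[f]$ is a well-defined analytic function on $\mathbb{U}$ with value $1$ at $z=0$. Removable singularities of $\Psi$ are removed. Best dominant: for a first-order differential subordination $\psi(\mathfrak{p}(z),z\mathfrak{p}'(z);z)\prec h(z)$, a function $q$ is a dominant if $\mathfrak{p}\prec q$ for all admissible analytic $\mathfrak{p}$ satisfying it; a univalent dominant $\tilde q$ with $\tilde q\prec q$ for all dominants $q$ is the best dominant. With $\mathfrak{p}=\mathscr{F}_p^{\eta,\mu}[f]$, the subordination $(\ast)$ is $\sigma\mathfrak{p}(z)+\gamma z\mathfrak{p}'(z)\prec\sigma q(z)+\gamma zq'(z)$, the admissible functions being the analytic $\mathfrak{p}$ on $\mathbb{U}$ with $\mathfrak{p}(0)=1$.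 *)

theory Defs
  imports "HOL-Complex_Analysis.Complex_Analysis"
begin

abbreviation unit_disc :: "complex set" where
  "unit_disc \<equiv> ball 0 1"

definition class_A :: "nat \<Rightarrow> (complex \<Rightarrow> complex) set" where
  "class_A p = {f. f holomorphic_on unit_disc \<and>
     (\<exists>a :: nat \<Rightarrow> complex. \<forall>z\<in>unit_disc. (\<lambda>k. a k * z ^ (p + 1 + k)) sums (f z - z ^ p))}"

definition subordinate :: "(complex \<Rightarrow> complex) \<Rightarrow> (complex \<Rightarrow> complex) \<Rightarrow> bool"
    (infix "\<prec>\<^sub>U" 50) where
  "g \<prec>\<^sub>U h \<longleftrightarrow> g holomorphic_on unit_disc \<and> h holomorphic_on unit_disc \<and>
     (\<exists>\<omega>. \<omega> holomorphic_on unit_disc \<and> \<omega> ` unit_disc \<subseteq> unit_disc \<and> \<omega> 0 = 0 \<and>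
       (\<forall>z\<in>unit_disc. g z = h (\<omega> z)))"

(* F is the analytic branch on the disc of (f'(z) / (p z^(p-1)))^eta * (z^p / f(z))^mu
   with value 1 at 0.  Both bases tend to 1 as z \<rightarrow> 0, so powr is their holomorphic principal
   power near 0; this determines F on the whole disc by analytic continuation.  The requirement
   is on the product only: f and f' may have zeros as long as the product extends
   holomorphically (for example for suitable integer exponents). *)
definition power_branch ::
    "nat \<Rightarrow> complex \<Rightarrow> complex \<Rightarrow> (complex \<Rightarrow> complex) \<Rightarrow> (complex \<Rightarrow> complex) \<Rightarrow> bool" where
  "power_branch p \<eta> \<mu> f F \<longleftrightarrow> F holomorphic_on unit_disc \<and> F 0 = 1 \<and>
     (\<forall>\<^sub>F z in at 0. F z =
        (deriv f z / (of_nat p * z ^ (p - 1))) powr \<eta> * (z ^ p / f z) powr \<mu>)"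

lemma power_branch_unique:
  assumes "power_branch p \<eta> \<mu> f F" "power_branch p \<eta> \<mu> f G" "z \<in> unit_disc"
  shows "F z = G z"
proof -
  have "\<forall>\<^sub>F z in at 0. F z = G z"
    using assms(1,2) unfolding power_branch_def by (auto elim: eventually_elim2)
  hence "\<exists>\<^sub>F z in at 0. F z - G z = 0"
    by (auto intro!: eventually_frequently elim: eventually_mono)
  hence "(0::complex) islimpt {z. F z - G z = 0}"
    by (simp add: islimpt_conv_frequently_at)
  hence lim: "(0::complex) islimpt {z. F z - G z = 0} \<inter> unit_disc"
    by (intro islimpt_Int_eventually eventually_at_in_open') auto
  have "F z - G z = 0"
  proof (rule analytic_continuation[of "\<lambda>z. F z - G z" unit_disc _ 0])
    show "(\<lambda>z. F z - G z) holomorphic_on unit_disc"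
      using assms(1,2) by (auto simp: power_branch_def intro!: holomorphic_intros)
  qed (use lim assms(3) in auto)
  thus ?thesis by simp
qed

definition class_A0 :: "nat \<Rightarrow> complex \<Rightarrow> complex \<Rightarrow> (complex \<Rightarrow> complex) set" where
  "class_A0 p \<eta> \<mu> = {f \<in> class_A p. \<exists>F. power_branch p \<eta> \<mu> f F}"

(* On the disc the choice is irrelevant by power_branch_unique;
   values outside the disc are never used. *)
definition F_op ::
    "nat \<Rightarrow> complex \<Rightarrow> complex \<Rightarrow> (complex \<Rightarrow> complex) \<Rightarrow> complex \<Rightarrow> complex" where
  "F_op p \<eta> \<mu> f = (SOME F. power_branch p \<eta> \<mu> f F)"

(* remove_sings gives the intended values at 0 and at the zeros of f and f', where the
   quotients below are only Isabelle's x / 0 = 0. *)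
definition Psi ::
    "nat \<Rightarrow> complex \<Rightarrow> complex \<Rightarrow> complex \<Rightarrow> complex \<Rightarrow> (complex \<Rightarrow> complex) \<Rightarrow> complex \<Rightarrow> complex" where
  "Psi p \<eta> \<mu> \<sigma> \<gamma> f = remove_sings (\<lambda>z. F_op p \<eta> \<mu> f z *
     (\<sigma> + \<gamma> * (\<eta> * (1 - of_nat p + z * deriv (deriv f) z / deriv f z)
               + \<mu> * (of_nat p - z * deriv f z / f z))))"

(* The differential subordination psi(P(z), z P'(z); z) \<prec> h(z), with P ranging over the set Adm
   of admissible functions. *)
definition dominant ::
    "(complex \<Rightarrow> complex \<Rightarrow> complex \<Rightarrow> complex) \<Rightarrow> (complex \<Rightarrow> complex) \<Rightarrow>
     (complex \<Rightarrow> complex) set \<Rightarrow> (complex \<Rightarrow> complex) \<Rightarrow> bool" where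
  "dominant \<psi> h Adm q \<longleftrightarrow> q holomorphic_on unit_disc \<and>
     (\<forall>P\<in>Adm. (\<lambda>z. \<psi> (P z) (z * deriv P z) z) \<prec>\<^sub>U h \<longrightarrow> P \<prec>\<^sub>U q)"

definition best_dominant ::
    "(complex \<Rightarrow> complex \<Rightarrow> complex \<Rightarrow> complex) \<Rightarrow> (complex \<Rightarrow> complex) \<Rightarrow>
     (complex \<Rightarrow> complex) set \<Rightarrow> (complex \<Rightarrow> complex) \<Rightarrow> bool" where
  "best_dominant \<psi> h Adm q \<longleftrightarrow> dominant \<psi> h Adm q \<and> inj_on q unit_disc \<and>
     (\<forall>g. dominant \<psi> h Adm g \<longrightarrow> q \<prec>\<^sub>U g)"

end

theory Submission
  imports Defs
begin

text \<open>
  Put \<open>c = \<sigma> / \<gamma>\<close> and let \<open>P\<close> satisfy \<open>c P + z P' = h \<circ> \<omega>\<close> with \<open>h = c q + z q'\<close>. If \<open>P\<close> leaves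
  \<open>q({|z| < \<rho>})\<close> inside \<open>{|z| < \<rho>}\<close>, consider the first exit point \<open>z\<^sub>0\<close>, with \<open>P(z\<^sub>0) = q(\<zeta>)\<close>
  and \<open>|\<zeta>| = \<rho>\<close>. Jack's lemma for \<open>q\<inverse> \<circ> P\<close> gives \<open>z\<^sub>0 P'(z\<^sub>0) = m n\<close> with \<open>m \<ge> 1\<close>, where
  \<open>n = \<zeta> q'(\<zeta>)\<close> is an outer normal of the convex set \<open>q({|z| < \<rho>})\<close> at \<open>q(\<zeta>)\<close>. Writing
  \<open>G = h \<circ> q\<inverse>\<close> and \<open>v = q(\<omega>(z\<^sub>0))\<close> this says \<open>G(v) - G(q(\<zeta>)) = (m - 1) n\<close>. The hypothesis
  on \<open>q\<close> yields \<open>Re G' > 0\<close>; integrating along the segment, \<open>(v - q(\<zeta>)) / n\<close> has nonnegative real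
  part, whereas this real part is negative because \<open>n\<close> is an outer normal and \<open>v\<close> is an interior point.
\<close>

section \<open>Supporting lines and convexity of the images of discs\<close>

text \<open>
  The argument of the tangent direction \<open>z q'(z)\<close> increases along the circle, by \<open>2\<pi>\<close> in total,
  so the component of \<open>q(z)\<close> along the normal at \<open>\<zeta>\<close> first decreases and then increases back.
\<close>

lemma convex_support_circle:
  assumes hol: "q holomorphic_on unit_disc"
    and reg: "\<And>z. z \<in> unit_disc \<Longrightarrow> deriv q z \<noteq> 0"
    and cvx: "\<And>z. z \<in> unit_disc \<Longrightarrow> Re (1 + z * deriv (deriv q) z / deriv q z) > 0"
    and \<zeta>: "\<zeta> \<in> unit_disc" "\<zeta> \<noteq> 0" and w: "norm w = norm \<zeta>"
  shows "Re ((q w - q \<zeta>) / (\<zeta> * deriv q \<zeta>)) \<le> 0"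
proof -
  \<comment> \<open>A holomorphic logarithm \<open>g\<close> of \<open>deriv q\<close> on the simply
    connected disc makes the argument of the tangent direction a globally continuous
    function.\<close>
  obtain g where g: "g holomorphic_on unit_disc"
    and qg: "\<And>z. z \<in> unit_disc \<Longrightarrow> deriv q z = exp (g z)"
    using contractible_imp_holomorphic_log[of "deriv q" unit_disc] hol reg
    by (metis convex_ball convex_imp_contractible holomorphic_deriv open_ball)
  have dg: "deriv g z = deriv (deriv q) z / deriv q z" if "z \<in> unit_disc" for z
  proof -
    have "((\<lambda>z. exp (g z)) has_field_derivative (exp (g z) * deriv g z)) (at z)"
      by (rule derivative_eq_intros refl holomorphic_derivI[OF g] that open_ball)+
    hence "(deriv q has_field_derivative (exp (g z) * deriv g z)) (at z)"
      by (rule has_field_derivative_transform_within_open[of _ _ _ unit_disc]) (use that qg in auto)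
    thus ?thesis
      using qg[OF that] by (simp add: DERIV_imp_deriv)
  qed
  define r where "r = norm \<zeta>"
  have r: "0 < r" "r < 1" using \<zeta> by (auto simp: r_def)
  define a where "a = Arg2pi \<zeta>"
  have \<zeta>_eq: "\<zeta> = r * cis a"
    using Arg2pi_eq[of \<zeta>] unfolding a_def r_def by (simp add: cis_conv_exp)
  obtain t where t: "a \<le> t" "t \<le> a + 2 * pi" "w = r * cis t"
  proof -
    have ww: "w = r * cis (Arg2pi w)"
      using Arg2pi_eq[of w] w unfolding r_def by (simp add: cis_conv_exp)
    show ?thesis
    proof (cases "a \<le> Arg2pi w")
      case True
      have "a \<ge> 0" "Arg2pi w < 2 * pi" by (auto simp: a_def Arg2pi_ge_0 Arg2pi_lt_2pi)
      thus ?thesis using ww True by (intro that[of "Arg2pi w"]) auto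
    next
      case False
      have "a < 2 * pi" "Arg2pi w \<ge> 0" by (auto simp: a_def Arg2pi_ge_0 Arg2pi_lt_2pi)
      moreover have "cis (Arg2pi w + 2 * pi) = cis (Arg2pi w)"
        by (simp add: complex_eq_iff)
      ultimately show ?thesis using ww False by (intro that[of "Arg2pi w + 2*pi"]) auto
    qed
  qed
  define zz where "zz s = complex_of_real r * cis s" for s
  have zz: "zz s \<in> unit_disc" for s using r by (simp add: zz_def norm_mult)
  have zz_per: "zz (s + 2*pi) = zz s" for s by (simp add: zz_def complex_eq_iff)
  have zz_a: "zz a = \<zeta>" using \<zeta>_eq by (simp add: zz_def)
  have dzz: "(zz has_vector_derivative (\<i> * zz s)) (at s within S)" for s S
  proof -
    have "((\<lambda>x. r * exp (\<i> * x)) has_field_derivative \<i> * zz s) (at (of_real s))"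
      by (auto intro!: derivative_eq_intros simp: zz_def cis_conv_exp)
    moreover have "zz = (\<lambda>x. r * exp (\<i> * complex_of_real x))"
      by (simp add: fun_eq_iff zz_def cis_conv_exp)
    ultimately show ?thesis
      using has_vector_derivative_real_field[of "\<lambda>x. r * exp (\<i> * x)" "\<i> * zz s" s S] by simp
  qed
  \<comment> \<open>Up to a constant multiple of 2 pi, \<open>A s\<close> is a continuous argument
    of \<open>zz s * deriv q (zz s)\<close>; \<open>u s\<close> is the component of
    \<open>q (zz s)\<close> along the normal at \<zeta>, scaled by a positive constant.\<close>
  define A where "A s = s + Im (g (zz s))" for s
  define u where "u s = Re (q (zz s) / (\<zeta> * deriv q \<zeta>))" for s
  have dA: "(A has_real_derivative (1 + Re (zz s * deriv g (zz s)))) (at s)" for s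
  proof -
    have "(g \<circ> zz has_vector_derivative (\<i> * zz s * deriv g (zz s))) (at s)"
      by (rule field_vector_diff_chain_at[OF dzz holomorphic_derivI[OF g open_ball zz]])
    hence "((\<lambda>s. Im (g (zz s))) has_vector_derivative Im (\<i> * zz s * deriv g (zz s))) (at s)"
      using bounded_linear.has_vector_derivative[OF bounded_linear_Im] by (auto simp only: o_def)
    thus ?thesis unfolding A_def has_real_derivative_iff_has_vector_derivative
      by (auto intro!: derivative_eq_intros)
  qed
  have dA_pos: "1 + Re (zz s * deriv g (zz s)) > 0" for s
    using cvx[OF zz] dg[OF zz] by simp
  have A_mono: "A s \<le> A s'" if "s \<le> s'" for s s'
    by (rule DERIV_nonneg_imp_nondecreasing[OF that]) (use dA dA_pos less_imp_le in blast)
  have A_per: "A (a + 2*pi) = A a + 2*pi" by (simp add: A_def zz_per)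
  \<comment> \<open>The derivative is the real part of \<i> times the ratio of the normals at
    \<open>zz s\<close> and at \<zeta>. That ratio has argument \<open>A s - A a\<close>, hence the
    sine.\<close>
  have du: "(u has_real_derivative - (exp (Re (g (zz s) - g \<zeta>)) * sin (A s - A a))) (at s)" for s
  proof -
    have "(q \<circ> zz has_vector_derivative (\<i> * zz s * deriv q (zz s))) (at s)"
      by (rule field_vector_diff_chain_at[OF dzz holomorphic_derivI[OF hol open_ball zz]])
    hence "((\<lambda>s. q (zz s) / (\<zeta> * deriv q \<zeta>)) has_vector_derivative
        (\<i> * zz s * deriv q (zz s) / (\<zeta> * deriv q \<zeta>))) (at s)"
      by (auto intro: has_vector_derivative_divide simp: o_def)
    hence "(u has_vector_derivative Re (\<i> * zz s * deriv q (zz s) / (\<zeta> * deriv q \<zeta>))) (at s)"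
      unfolding u_def using bounded_linear.has_vector_derivative[OF bounded_linear_Re] by blast
    also have "\<i> * zz s * deriv q (zz s) / (\<zeta> * deriv q \<zeta>)
        = \<i> * (exp (g (zz s) - g \<zeta>) * cis (s - a))"
      unfolding qg[OF zz] qg[OF \<zeta>(1)]
      using r by (simp add: exp_diff zz_def \<zeta>_eq cis_divide[symmetric] mult.commute)
    also have "exp (g (zz s) - g \<zeta>) * cis (s - a)
        = of_real (exp (Re (g (zz s) - g \<zeta>))) * cis (A s - A a)"
      by (simp add: exp_eq_polar[of "g (zz s) - g \<zeta>"] cis_mult A_def zz_a algebra_simps)
    finally show ?thesis by (simp add: has_real_derivative_iff_has_vector_derivative)
  qed
  have "\<exists>b. a \<le> b \<and> b \<le> a + 2*pi \<and> A b = A a + pi"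
  proof (rule IVT')
    show "continuous_on {a..a + 2*pi} A"
      by (rule DERIV_continuous_on) (use dA has_field_derivative_at_within in blast)
  qed (use A_per pi_gt_zero in simp_all)
  \<comment> \<open>At \<open>b\<close> the tangent has turned by exactly half a revolution: the
    sine is nonnegative before \<open>b\<close> and nonpositive after it. Periodicity brings
    \<open>u\<close> back to its initial value at \<open>a + 2*pi\<close>.\<close>
  then obtain b where b: "a \<le> b" "b \<le> a + 2*pi" "A b = A a + pi" by blast
  have "u t \<le> u a"
  proof (cases "t \<le> b")
    case True
    show ?thesis
    proof (rule DERIV_nonpos_imp_nonincreasing[OF t(1)])
      fix s assume s: "a \<le> s" "s \<le> t"
      have "sin (A s - A a) \<ge> 0"
        using A_mono[of a s] A_mono[of s b] s True b by (intro sin_ge_zero) auto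
      thus "\<exists>y. (u has_real_derivative y) (at s) \<and> y \<le> 0" using du[of s] by fastforce
    qed
  next
    case False
    have "u t \<le> u (a + 2*pi)"
    proof (rule DERIV_nonneg_imp_nondecreasing[OF t(2)])
      fix s assume s: "t \<le> s" "s \<le> a + 2*pi"
      have "sin ((A s - A a) - pi) \<ge> 0"
        using A_mono[of b s] A_mono[of s "a + 2*pi"] s False b A_per by (intro sin_ge_zero) auto
      hence "sin (A s - A a) \<le> 0" unfolding sin_diff[of _ pi] by simp
      thus "\<exists>y. (u has_real_derivative y) (at s) \<and> y \<ge> 0"
        using du[of s] by (meson exp_ge_zero mult_nonneg_nonpos neg_0_le_iff_le)
    qed
    thus ?thesis by (simp add: u_def zz_per)
  qed
  hence "Re (q (zz t) / (\<zeta> * deriv q \<zeta>)) \<le> Re (q \<zeta> / (\<zeta> * deriv q \<zeta>))"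
    by (simp add: u_def zz_a)
  thus ?thesis using t(3) by (simp add: diff_divide_distrib zz_def)
qed

text \<open>The maximum principle for real parts carries the weak inequality from the circle to the
  disc. It becomes strict because the image of the open disc is open, which leaves room to move
  outward from \<open>q w\<close>.\<close>

lemma convex_support_ball:
  assumes hol: "q holomorphic_on unit_disc"
    and reg: "\<And>z. z \<in> unit_disc \<Longrightarrow> deriv q z \<noteq> 0"
    and inj: "inj_on q unit_disc"
    and cvx: "\<And>z. z \<in> unit_disc \<Longrightarrow> Re (1 + z * deriv (deriv q) z / deriv q z) > 0"
    and \<zeta>: "\<zeta> \<in> unit_disc" "\<zeta> \<noteq> 0" and w: "norm w < norm \<zeta>"
  shows "Re ((q w - q \<zeta>) / (\<zeta> * deriv q \<zeta>)) < 0"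
proof -
  let ?B = "ball (0::complex) (norm \<zeta>)"
  let ?n = "\<zeta> * deriv q \<zeta>"
  have n: "?n \<noteq> 0" using reg[OF \<zeta>(1)] \<zeta> by auto
  have sub: "ball 0 (norm \<zeta>) \<subseteq> unit_disc" "cball 0 (norm \<zeta>) \<subseteq> unit_disc" using \<zeta> by auto
  have hol': "(\<lambda>z. (q z - q \<zeta>) / ?n) holomorphic_on unit_disc"
    using n by (intro holomorphic_intros hol) auto
  have le: "Re ((q z - q \<zeta>) / ?n) \<le> 0" if "z \<in> ?B" for z
  proof (rule maximum_real_frontier[where S = ?B and f = "\<lambda>z. (q z - q \<zeta>) / ?n"])
    show "(\<lambda>z. (q z - q \<zeta>) / ?n) holomorphic_on interior ?B"
      using holomorphic_on_subset[OF hol' sub(1)] by simp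
    show "continuous_on (closure ?B) (\<lambda>z. (q z - q \<zeta>) / ?n)"
      using holomorphic_on_imp_continuous_on[OF holomorphic_on_subset[OF hol' sub(2)]] \<zeta> by simp
  qed (use that \<zeta> convex_support_circle[OF hol reg cvx \<zeta>] in \<open>auto simp: frontier_ball\<close>)
  have "open (q ` ?B)"
    using open_mapping_thm3[OF holomorphic_on_subset[OF hol sub(1)] open_ball inj_on_subset[OF inj sub(1)]] .
  moreover have "q w \<in> q ` ?B" using w by simp
  ultimately obtain e where e: "e > 0" "cball (q w) e \<subseteq> q ` ?B"
    by (meson open_contains_cball)
  \<comment> \<open>A step of length \<open>e\<close> in the direction of the normal stays in the
    image and raises the real part by \<open>e / norm ?n\<close>.\<close>
  have "q w + of_real (e / norm ?n) * ?n \<in> cball (q w) e"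
    using e n by (simp add: dist_norm norm_mult norm_divide)
  then obtain v where v: "v \<in> ?B" "q v = q w + of_real (e / norm ?n) * ?n" using e by fastforce
  have "(q v - q \<zeta>) / ?n = (q w - q \<zeta>) / ?n + of_real (e / norm ?n)"
    using n by (simp add: v(2) diff_divide_distrib add_divide_distrib del: of_real_divide)
  hence "Re ((q v - q \<zeta>) / ?n) = Re ((q w - q \<zeta>) / ?n) + e / norm ?n"
    by (simp del: of_real_divide)
  moreover have "e / norm ?n > 0" using e n by simp
  ultimately show ?thesis using le[OF v(1)] by linarith
qed

text \<open>The image is closed, has \<open>q 0\<close> in its interior, and has a supporting line
  at each boundary point. It is needed to keep a segment between two image points inside the domain
  of the inverse of \<open>q\<close>.\<close>

lemma convex_image_cball:
  assumes hol: "q holomorphic_on unit_disc"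
    and reg: "\<And>z. z \<in> unit_disc \<Longrightarrow> deriv q z \<noteq> 0"
    and inj: "inj_on q unit_disc"
    and cvx: "\<And>z. z \<in> unit_disc \<Longrightarrow> Re (1 + z * deriv (deriv q) z / deriv q z) > 0"
    and r: "0 < r" "r < 1"
  shows "convex (q ` cball 0 r)"
proof (rule ccontr)
  let ?K = "q ` cball 0 r"
  have sub: "ball 0 r \<subseteq> unit_disc" "cball 0 r \<subseteq> unit_disc" using r by auto
  assume "\<not> convex ?K"
  then obtain x y z where xyz: "x \<in> ?K" "y \<in> ?K" "z \<in> closed_segment x y" "z \<notin> ?K"
    unfolding convex_contains_segment by blast
  have "closed ?K"
    using compact_continuous_image[OF holomorphic_on_imp_continuous_on[OF holomorphic_on_subset[OF hol sub(2)]]]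
    by (simp add: compact_imp_closed)
  have "open (q ` ball 0 r)"
    using open_mapping_thm3[OF holomorphic_on_subset[OF hol sub(1)] open_ball inj_on_subset[OF inj sub(1)]] .
  hence int: "q ` ball 0 r \<subseteq> interior ?K" by (intro interior_maximal) auto
  \<comment> \<open>Going from \<open>q 0\<close> to the outside point \<open>z\<close> crosses the
    boundary at some \<open>b\<close> before \<open>z\<close>. The functional \<open>L\<close>
    supporting at \<open>b\<close> is negative at \<open>q 0\<close> and nonpositive at
    \<open>z\<close>, yet zero at \<open>b\<close>.\<close>
  have "closed_segment (q 0) z \<inter> frontier ?K \<noteq> {}"
  proof (rule connected_Int_frontier)
    have "q 0 \<in> closed_segment (q 0) z \<inter> ?K" using r by auto
    thus "closed_segment (q 0) z \<inter> ?K \<noteq> {}" by blast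
    show "closed_segment (q 0) z - ?K \<noteq> {}" using xyz by auto
  qed simp
  then obtain b where b: "b \<in> closed_segment (q 0) z" "b \<in> frontier ?K" by blast
  hence bK: "b \<in> ?K" "b \<notin> q ` ball 0 r"
    using \<open>closed ?K\<close> int by (auto simp: frontier_def)
  then obtain \<zeta> where \<zeta>: "b = q \<zeta>" "norm \<zeta> = r"
    by (force simp: image_iff)
  have \<zeta>': "\<zeta> \<in> unit_disc" "\<zeta> \<noteq> 0" using \<zeta> r by auto
  define L where "L v = Re ((v - b) / (\<zeta> * deriv q \<zeta>))" for v
  have conv: "L ((1 - s) *\<^sub>R v + s *\<^sub>R v') = (1 - s) * L v + s * L v'" for s v v'
  proof -
    have "((1 - s) *\<^sub>R v + s *\<^sub>R v' - b) / (\<zeta> * deriv q \<zeta>)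
      = (1 - s) *\<^sub>R ((v - b) / (\<zeta> * deriv q \<zeta>)) + s *\<^sub>R ((v' - b) / (\<zeta> * deriv q \<zeta>))"
      by (simp add: scaleR_conv_of_real add_divide_distrib diff_divide_distrib algebra_simps)
    thus ?thesis unfolding L_def by simp
  qed
  have L0: "L (q 0) < 0"
    using convex_support_ball[OF hol reg inj cvx \<zeta>', of 0] \<zeta> r by (auto simp: L_def)
  have LK: "L v \<le> 0" if vK: "v \<in> ?K" for v
  proof -
    obtain w where w: "v = q w" "norm w \<le> r" using vK by auto
    thus ?thesis
      using convex_support_ball[OF hol reg inj cvx \<zeta>', of w]
        convex_support_circle[OF hol reg cvx \<zeta>', of w] \<zeta>
      unfolding L_def by fastforce
  qed
  obtain s where s: "0 \<le> s" "s \<le> 1" "z = (1 - s) *\<^sub>R x + s *\<^sub>R y"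
    using xyz(3) by (auto simp: in_segment)
  have "(1 - s) * L x \<le> 0" "s * L y \<le> 0"
    using s LK xyz by (auto simp: mult_nonneg_nonpos)
  hence Lz: "L z \<le> 0" using conv[of s x y] s by simp
  obtain t where t: "0 \<le> t" "t \<le> 1" "b = (1 - t) *\<^sub>R q 0 + t *\<^sub>R z"
    using b(1) by (auto simp: in_segment)
  have "t \<noteq> 1" using t bK xyz by auto
  hence "(1 - t) * L (q 0) < 0" using t L0 by (intro mult_pos_neg) auto
  moreover have "t * L z \<le> 0" using t Lz by (simp add: mult_nonneg_nonpos)
  moreover have "L b = 0" by (simp add: L_def)
  ultimately show False using conv[of t "q 0" z] t by simp
qed

section \<open>Jack's lemma and slopes along segments\<close>

text \<open>
  By Schwarz, \<open>\<psi>(z) = \<phi>(z\<^sub>0 z) / \<phi>(z\<^sub>0)\<close> satisfies \<open>|\<psi>(e\<^sup>s) e\<^sup>-\<^sup>s| \<le> 1\<close> for \<open>Re s < 0\<close>, with value 1 at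
  \<open>s = 0\<close>; hence the derivative \<open>M - 1\<close> there satisfies \<open>Re (s (M - 1)) \<le> 0\<close> for all such \<open>s\<close>.
\<close>

lemma Jack_lemma:
  assumes hol: "\<phi> holomorphic_on ball 0 (norm z0)"
    and der: "(\<phi> has_field_derivative d) (at z0)"
    and "\<phi> 0 = 0" and z0: "z0 \<noteq> 0"
    and less: "\<And>z. norm z < norm z0 \<Longrightarrow> norm (\<phi> z) < norm (\<phi> z0)"
  obtains m :: real where "m \<ge> 1" "z0 * d = of_real m * \<phi> z0"
proof -
  have \<phi>0: "\<phi> z0 \<noteq> 0" using less[of 0] z0 \<open>\<phi> 0 = 0\<close> by auto
  define \<psi> where "\<psi> z = \<phi> (z0 * z) / \<phi> z0" for z
  define M where "M = z0 * d / \<phi> z0"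
  have bd: "norm (\<psi> z) \<le> norm z" if "norm z < 1" for z
  proof (rule Schwarz_Lemma(1)[OF _ _ _ that])
    have "(\<phi> \<circ> (*) z0) holomorphic_on unit_disc"
      by (rule holomorphic_on_compose_gen[OF _ hol]) (use z0 in \<open>auto intro!: holomorphic_intros simp: norm_mult\<close>)
    thus "\<psi> holomorphic_on unit_disc"
      unfolding \<psi>_def o_def using \<phi>0 by (intro holomorphic_intros) auto
    show "\<psi> 0 = 0" using \<open>\<phi> 0 = 0\<close> by (simp add: \<psi>_def)
    show "norm (\<psi> z) < 1" if "norm z < 1" for z
      using less[of "z0 * z"] \<phi>0 z0 that by (simp add: \<psi>_def norm_mult norm_divide)
  qed
  have d\<psi>: "(\<psi> has_field_derivative M) (at 1)"
  proof -
    have "((\<lambda>z. \<phi> (z0 * z)) has_field_derivative (d * z0)) (at 1)"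
      using DERIV_chain2[of \<phi> d "\<lambda>z. z0 * z" 1 z0] der by (auto intro!: derivative_eq_intros)
    from DERIV_cdivide[OF this, of "\<phi> z0"] show ?thesis
      unfolding \<psi>_def M_def by (simp add: mult.commute)
  qed
  have key: "Re (s * (M - 1)) \<le> 0" if s: "Re s < 0" for s
  proof (rule ccontr)
    assume pos: "\<not> ?thesis"
    \<comment> \<open>For \<open>t > 0\<close> the point \<open>exp (t * s)\<close> lies in the unit
      disc, so \<open>bd\<close> gives \<open>k t \<le> 1 = k 0\<close>. A positive derivative at 0
      would contradict this.\<close>
    define k where "k t = Re (\<psi> (exp (of_real t * s)) * exp (- (of_real t * s)))" for t :: real
    have "(\<psi> \<circ> (\<lambda>z. exp (z * s)) has_field_derivative (M * s)) (at 0)"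
      by (rule DERIV_chain) (auto intro!: derivative_eq_intros d\<psi>)
    moreover have "((\<lambda>z. exp (- (z * s))) has_field_derivative (- s)) (at 0)"
      by (auto intro!: derivative_eq_intros)
    ultimately have "((\<lambda>z. (\<psi> \<circ> (\<lambda>z. exp (z * s))) z * exp (- (z * s)))
        has_field_derivative (M * s * exp (- (0 * s)) + (- s) * (\<psi> \<circ> (\<lambda>z. exp (z * s))) 0)) (at 0)"
      by (rule DERIV_mult)
    moreover have "M * s * exp (- (0 * s)) + (- s) * (\<psi> \<circ> (\<lambda>z. exp (z * s))) 0 = s * (M - 1)"
      by (simp add: \<psi>_def \<phi>0 algebra_simps)
    ultimately have "((\<lambda>z. \<psi> (exp (z * s)) * exp (- (z * s))) has_field_derivative (s * (M - 1))) (at 0)"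
      by (simp add: o_def)
    hence "((\<lambda>t. \<psi> (exp (of_real t * s)) * exp (- (of_real t * s)))
        has_vector_derivative (s * (M - 1))) (at 0)"
      using has_vector_derivative_real_field
        [of "\<lambda>z. \<psi> (exp (z * s)) * exp (- (z * s))" _ 0 UNIV] by simp
    hence "(k has_vector_derivative Re (s * (M - 1))) (at 0)"
      unfolding k_def o_def using bounded_linear.has_vector_derivative[OF bounded_linear_Re] by blast
    hence "(k has_real_derivative Re (s * (M - 1))) (at 0)"
      by (simp add: has_real_derivative_iff_has_vector_derivative)
    then obtain e where e: "e > 0" "\<And>h. 0 < h \<Longrightarrow> h < e \<Longrightarrow> k 0 < k h"
      using has_real_derivative_pos_inc_right[of k "Re (s * (M - 1))" 0 UNIV] pos
      unfolding not_le by auto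
    have "k 0 < k (e/2)" using e by simp
    moreover have "k 0 = 1" by (simp add: k_def \<psi>_def \<phi>0)
    moreover have "k (e/2) \<le> 1"
    proof -
      let ?w = "exp (of_real (e/2) * s)"
      have w1: "norm ?w < 1" using s e by (simp add: mult_pos_neg)
      hence "norm (\<psi> ?w * exp (- (of_real (e/2) * s))) \<le> norm ?w * norm (exp (- (of_real (e/2) * s)))"
        unfolding norm_mult by (intro mult_right_mono bd w1 norm_ge_zero)
      also have "\<dots> = 1" by (simp flip: exp_add)
      finally show ?thesis unfolding k_def using complex_Re_le_cmod order_trans by blast
    qed
    ultimately show False by simp
  qed
  have im: "Im M = 0"
  proof (rule ccontr)
    assume "Im M \<noteq> 0"
    \<comment> \<open>Taking \<open>s = -e - \<i> * Im M\<close> in \<open>key\<close> produces the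
      term \<open>(Im M)\<^sup>2\<close>; \<open>e\<close> is so small that the other term is at
      most half of it in absolute value.\<close>
    define K where "K = \<bar>Re M - 1\<bar> + 1"
    have "K > 0" by (simp add: K_def add_nonneg_pos)
    define e where "e = (Im M)\<^sup>2 / (2 * K)"
    have "e > 0" using \<open>Im M \<noteq> 0\<close> \<open>K > 0\<close> by (simp add: e_def)
    have "e * \<bar>Re M - 1\<bar> \<le> e * K" using \<open>e > 0\<close> by (simp add: K_def)
    also have "\<dots> = (Im M)\<^sup>2 / 2" using \<open>K > 0\<close> by (simp add: e_def)
    finally have "e * \<bar>Re M - 1\<bar> \<le> (Im M)\<^sup>2 / 2" .
    moreover have "e * (Re M - 1) \<le> e * \<bar>Re M - 1\<bar>" using \<open>e > 0\<close> by simp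
    moreover have "- e * (Re M - 1) + (Im M)\<^sup>2 \<le> 0"
      using key[of "Complex (-e) (- Im M)"] \<open>e > 0\<close> by (simp add: power2_eq_square)
    moreover have "(Im M)\<^sup>2 > 0" using \<open>Im M \<noteq> 0\<close> by simp
    ultimately show False by simp
  qed
  have "Re M \<ge> 1" using key[of "-1"] by simp
  moreover have "M = of_real (Re M)" using im by (simp add: complex_eq_iff)
  hence "z0 * d = of_real (Re M) * \<phi> z0" using \<phi>0 by (metis M_def nonzero_divide_eq_eq)
  ultimately show ?thesis using that by blast
qed

text \<open>The slope is the average of \<open>deriv G\<close> over the segment, and an average of
  values with positive real part has positive real part.\<close>

lemma Re_deriv_pos_imp_Re_slope_pos:
  assumes "open S" and G: "G holomorphic_on S"
    and pos: "\<And>z. z \<in> S \<Longrightarrow> Re (deriv G z) > 0"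
    and seg: "closed_segment a b \<subseteq> S" and "a \<noteq> b"
  shows "Re ((G b - G a) / (b - a)) > 0"
proof -
  define k where "k t = Re (G (a + of_real t * (b - a)) / (b - a))" for t
  have "k 0 < k 1"
  proof (rule DERIV_pos_imp_increasing[of 0 1 k])
    fix t :: real assume t: "0 \<le> t" "t \<le> 1"
    let ?z = "a + of_real t * (b - a)"
    have "?z \<in> closed_segment a b"
      using t by (auto simp: in_segment scaleR_conv_of_real algebra_simps intro!: exI[of _ t])
    hence z: "?z \<in> S" using seg by blast
    have "((\<lambda>s. G (a + s * (b - a)) / (b - a)) has_field_derivative
        deriv G ?z * (b - a) / (b - a)) (at (of_real t))"
      by (rule DERIV_cdivide, rule DERIV_chain2[where f = G],
          rule holomorphic_derivI[OF G \<open>open S\<close> z]) (auto intro!: derivative_eq_intros)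
    from has_vector_derivative_real_field[OF this]
    have "(k has_real_derivative Re (deriv G ?z)) (at t)"
      unfolding k_def has_real_derivative_iff_has_vector_derivative
      using bounded_linear.has_vector_derivative[OF bounded_linear_Re] \<open>a \<noteq> b\<close> by fastforce
    thus "\<exists>y. (k has_real_derivative y) (at t) \<and> y > 0" using pos[OF z] by blast
  qed simp
  thus ?thesis by (simp add: k_def diff_divide_distrib)
qed

section \<open>Differential subordination with a convex dominant\<close>

lemma convex_differential_subordination:
  assumes hol: "q holomorphic_on unit_disc" and inj: "inj_on q unit_disc"
    and cvx: "\<And>z. z \<in> unit_disc \<Longrightarrow>
           Re (1 + z * deriv (deriv q) z / deriv q z) > max 0 (- Re c)"
    and P: "P holomorphic_on unit_disc" "P 0 = q 0"
    and sub: "(\<lambda>z. c * P z + z * deriv P z) \<prec>\<^sub>U (\<lambda>z. c * q z + z * deriv q z)"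
  shows "P \<prec>\<^sub>U q"
proof -
  have reg: "deriv q z \<noteq> 0" if "z \<in> unit_disc" for z
    using holomorphic_injective_imp_regular[OF hol open_ball inj that] .
  have cvx0: "Re (1 + z * deriv (deriv q) z / deriv q z) > 0" if "z \<in> unit_disc" for z
    using cvx[OF that] by simp
  obtain g where g: "g holomorphic_on q ` unit_disc"
    and dg: "\<And>z. z \<in> unit_disc \<Longrightarrow> deriv q z * deriv g (q z) = 1"
    and gq: "\<And>z. z \<in> unit_disc \<Longrightarrow> g (q z) = z"
    using holomorphic_has_inverse[OF hol open_ball inj] by metis
  have opq: "open (q ` unit_disc)" by (rule open_mapping_thm3[OF hol open_ball inj])
  obtain \<omega> where \<omega>: "\<omega> holomorphic_on unit_disc" "\<omega> ` unit_disc \<subseteq> unit_disc" "\<omega> 0 = 0"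
    and eq: "\<And>z. z \<in> unit_disc \<Longrightarrow>
      c * P z + z * deriv P z = c * q (\<omega> z) + \<omega> z * deriv q (\<omega> z)"
    using sub unfolding subordinate_def by blast
  \<comment> \<open>In the coordinate \<open>u = q z\<close> the dominating function is
    \<open>G\<close>. Its derivative there is \<open>c + 1 + z q''(z) / q'(z)\<close>, so the bound
    by \<open>- Re c\<close> says exactly that \<open>Re G' > 0\<close>.\<close>
  define G where "G u = c * u + g u * deriv q (g u)" for u
  have dG': "(G has_field_derivative (c + (1 + z * deriv (deriv q) z / deriv q z))) (at (q z))"
    if z: "z \<in> unit_disc" for z
  proof -
    have g': "(g has_field_derivative deriv g (q z)) (at (q z))"
      by (rule holomorphic_derivI[OF g opq]) (use z in auto)
    have q': "(deriv q has_field_derivative deriv (deriv q) z) (at (g (q z)))"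
      unfolding gq[OF z] by (rule holomorphic_derivI[OF holomorphic_deriv[OF hol open_ball] open_ball z])
    have "(G has_field_derivative
        (c * 1 + (deriv g (q z) * deriv q z + deriv (deriv q) z * deriv g (q z) * z))) (at (q z))"
      using DERIV_add[OF DERIV_cmult[OF DERIV_ident] DERIV_mult[OF g' DERIV_chain2[OF q' g']]] 
      unfolding G_def gq[OF z] .
    moreover have "deriv g (q z) = 1 / deriv q z" using dg[OF z] reg[OF z] by (simp add: field_simps)
    ultimately show ?thesis using reg[OF z] by (simp add: field_simps)
  qed
  have G: "G holomorphic_on q ` unit_disc"
    unfolding holomorphic_on_open[OF opq] using dG' by blast
  have G_pos: "Re (deriv G u) > 0" if u: "u \<in> q ` unit_disc" for u
    using u cvx dG'[THEN DERIV_imp_deriv] by fastforce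
  \<comment> \<open>Working at radii \<rho> below 1 puts the first exit value on \<open>q\<close> of
    a circle inside the open disc, where \<open>q\<close> and its derivative are available.\<close>
  have main: "P ` ball 0 \<rho> \<subseteq> q ` ball 0 \<rho>" if \<rho>: "0 < \<rho>" "\<rho> < 1" for \<rho>
  proof (rule ccontr)
    assume "\<not> ?thesis"
    then obtain z1 where z1: "norm z1 < \<rho>" "P z1 \<notin> q ` ball 0 \<rho>"
      by (auto simp: image_subset_iff simp del: image_iff)
    let ?D = "q ` ball 0 \<rho>" and ?K = "q ` cball 0 \<rho>"
    have subs: "ball 0 \<rho> \<subseteq> unit_disc" "cball 0 \<rho> \<subseteq> unit_disc" using \<rho> by auto
    have "open ?D"
      using open_mapping_thm3[OF holomorphic_on_subset[OF hol subs(1)] open_ball inj_on_subset[OF inj subs(1)]] .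
    have "closed ?K"
      using compact_continuous_image[OF holomorphic_on_imp_continuous_on[OF holomorphic_on_subset[OF hol subs(2)]]]
      by (simp add: compact_imp_closed)
    \<comment> \<open>Restricting to \<open>norm z \<le> norm z1\<close> makes the set of exit
      points compact, so one of least modulus exists; it is the first exit point
      \<open>z0\<close>.\<close>
    define C where "C = cball 0 (norm z1) \<inter> P -` (- ?D)"
    have "continuous_on (cball 0 (norm z1)) P"
      using z1 \<rho> by (intro holomorphic_on_imp_continuous_on holomorphic_on_subset[OF P(1)]) auto
    hence "closed C" unfolding C_def
      by (rule continuous_closed_preimage) (use \<open>open ?D\<close> in auto)
    hence "compact C" unfolding C_def
      by (metis compact_Int_closed compact_cball inf.left_idem)
    moreover have "C \<noteq> {}" using z1 by (auto simp: C_def)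
    ultimately obtain z0 where z0: "z0 \<in> C" "\<And>z. z \<in> C \<Longrightarrow> norm z0 \<le> norm z"
      using continuous_attains_inf[of C norm] continuous_on_norm_id by blast
    have z0\<rho>: "norm z0 < \<rho>" and Pz0: "P z0 \<notin> ?D" using z0(1) z1 by (auto simp: C_def)
    have z0U: "z0 \<in> unit_disc" using z0\<rho> \<rho> by simp
    have inD: "P z \<in> ?D" if "norm z < norm z0" for z
    proof (rule ccontr)
      assume "P z \<notin> ?D"
      moreover have "norm z \<le> norm z1" using that z0(1) by (simp add: C_def)
      ultimately have "z \<in> C" by (simp add: C_def)
      thus False using z0(2) that by fastforce
    qed
    have "z0 \<noteq> 0" using Pz0 P(2) \<rho> by auto
    have "P ` closure (ball 0 (norm z0)) \<subseteq> ?K"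
    proof (rule image_closure_subset)
      show "continuous_on (closure (ball 0 (norm z0))) P"
        using \<open>z0 \<noteq> 0\<close> z0U
        by (intro holomorphic_on_imp_continuous_on holomorphic_on_subset[OF P(1)]) auto
    qed (use inD \<open>closed ?K\<close> in fastforce)+
    hence "P z0 \<in> ?K" using \<open>z0 \<noteq> 0\<close> by auto
    then obtain \<zeta> where \<zeta>: "P z0 = q \<zeta>" "norm \<zeta> = \<rho>"
      using Pz0 by (force simp: image_iff)
    have \<zeta>': "\<zeta> \<in> unit_disc" "\<zeta> \<noteq> 0" using \<zeta> \<rho> by auto
    define n where "n = \<zeta> * deriv q \<zeta>"
    have n: "n \<noteq> 0" using \<zeta>' reg by (simp add: n_def)
    \<comment> \<open>Before the exit \<open>g \<circ> P\<close> has modulus below \<rho>, and at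
      \<open>z0\<close> it equals \<zeta>, of modulus \<rho>; this is the strict maximum that Jack's
      lemma requires.\<close>
    obtain m where m: "m \<ge> 1" "z0 * (deriv g (q \<zeta>) * deriv P z0) = of_real m * (g \<circ> P) z0"
    proof (rule Jack_lemma[of "g \<circ> P" z0 "deriv g (q \<zeta>) * deriv P z0"])
      show "g \<circ> P holomorphic_on ball 0 (norm z0)"
      proof (rule holomorphic_on_compose_gen[OF _ g])
        show "P holomorphic_on ball 0 (norm z0)"
          using z0U by (intro holomorphic_on_subset[OF P(1)]) auto
        show "P ` ball 0 (norm z0) \<subseteq> q ` unit_disc"
          using inD subs(1) by fastforce
      qed
      show "(g \<circ> P has_field_derivative deriv g (q \<zeta>) * deriv P z0) (at z0)"
      proof (rule DERIV_chain)
        show "(g has_field_derivative deriv g (q \<zeta>)) (at (P z0))"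
          unfolding \<zeta>(1) by (rule holomorphic_derivI[OF g opq]) (use \<zeta>' in auto)
        show "(P has_field_derivative deriv P z0) (at z0)"
          by (rule holomorphic_derivI[OF P(1) open_ball z0U])
      qed
      show "(g \<circ> P) 0 = 0" using P(2) gq[of 0] by simp
      show "norm ((g \<circ> P) z) < norm ((g \<circ> P) z0)" if z: "norm z < norm z0" for z
      proof -
        obtain w where w: "P z = q w" "norm w < \<rho>" using inD[OF z] by auto
        thus ?thesis using gq[of w] gq[OF \<zeta>'(1)] \<zeta> \<rho> by simp
      qed
    qed (use \<open>z0 \<noteq> 0\<close> in blast)+
    have "(g \<circ> P) z0 = \<zeta>" using \<zeta> gq[OF \<zeta>'(1)] by simp
    hence "z0 * deriv P z0 * (deriv q \<zeta> * deriv g (q \<zeta>)) = of_real m * n"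
      using m(2) by (simp add: n_def algebra_simps)
    hence zP: "z0 * deriv P z0 = of_real m * n" using dg[OF \<zeta>'(1)] by simp
    define v where "v = \<omega> z0"
    \<comment> \<open>Schwarz's lemma for \<omega> keeps \<open>v\<close> strictly inside radius
      \<rho>, which gives the strict sign of \<open>Re x\<close> below.\<close>
    have "norm v \<le> norm z0" unfolding v_def
      using Schwarz_Lemma(1)[OF \<omega>(1,3)] \<omega>(2) z0U by (force simp: image_subset_iff)
    hence v: "norm v < \<rho>" using z0\<rho> by simp
    hence vU: "v \<in> unit_disc" using \<rho> by simp
    define x where "x = (q v - q \<zeta>) / n"
    have x: "Re x < 0"
      unfolding x_def n_def using convex_support_ball[OF hol reg inj cvx0 \<zeta>'] v \<zeta> by blast
    have "closed_segment (q \<zeta>) (q v) \<subseteq> ?K"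
      using convex_image_cball[OF hol reg inj cvx0 \<rho>] \<zeta> v
      by (intro closed_segment_subset) auto
    hence "closed_segment (q \<zeta>) (q v) \<subseteq> q ` unit_disc" using subs by blast
    moreover have "q \<zeta> \<noteq> q v" using x by (auto simp: x_def)
    ultimately have "Re ((G (q v) - G (q \<zeta>)) / (q v - q \<zeta>)) > 0"
      by (intro Re_deriv_pos_imp_Re_slope_pos[OF opq G G_pos])
    \<comment> \<open>The slope of \<open>G\<close> from \<open>q \<zeta>\<close> to
      \<open>q v\<close> is \<open>(m - 1) / x\<close>: its real part is positive by
      \<open>G_pos\<close>, but nonpositive because \<open>m \<ge> 1\<close> and
      \<open>Re x < 0\<close>.\<close>
    moreover have "G (q v) = c * q v + v * deriv q v" "G (q \<zeta>) = c * q \<zeta> + n"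
      using gq[OF vU] gq[OF \<zeta>'(1)] by (simp_all add: G_def n_def)
    hence "G (q v) - G (q \<zeta>) = of_real (m - 1) * n"
      using eq[OF z0U, folded v_def] \<zeta>(1) zP by (simp add: algebra_simps)
    hence "(G (q v) - G (q \<zeta>)) / (q v - q \<zeta>) = of_real (m - 1) * inverse x"
      by (simp add: x_def)
    ultimately have "(m - 1) * Re (inverse x) > 0"
      by (metis Re_complex_of_real times_complex.sel(1) Im_complex_of_real mult_zero_left diff_zero)
    moreover have "Re (inverse x) \<le> 0" using x by (simp add: divide_nonpos_nonneg)
    ultimately show False
      using mult_nonneg_nonpos[of "m - 1" "Re (inverse x)"] m(1) by linarith
  qed
  have PU: "P ` unit_disc \<subseteq> q ` unit_disc"
  proof safe
    fix z assume "z \<in> unit_disc"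
    then obtain \<rho> where "norm z < \<rho>" "\<rho> < 1" using dense[of "norm z" 1] by auto
    moreover from this have "0 < \<rho>" using norm_ge_zero[of z] by linarith
    ultimately have "P z \<in> q ` ball 0 \<rho>" using main[of \<rho>] by auto
    thus "P z \<in> q ` unit_disc" using \<open>\<rho> < 1\<close> by auto
  qed
  have "g \<circ> P holomorphic_on unit_disc"
    by (rule holomorphic_on_compose_gen[OF P(1) g PU])
  moreover have "(g \<circ> P) 0 = 0" using P(2) gq[of 0] by simp
  moreover have "g (P z) \<in> unit_disc \<and> P z = q (g (P z))" if "z \<in> unit_disc" for z
    using PU that gq by fastforce
  ultimately show ?thesis
    unfolding subordinate_def using P hol by (intro conjI exI[of _ "g \<circ> P"]) auto
qed

section \<open>The function \<open>Psi\<close> as a first-order expression in the power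
  branch\<close>

text \<open>This form of the identity theorem serves both to continue an identity known near 0 and
  to show that zeros are isolated.\<close>

lemma holomorphic_frequently_zero:
  assumes h: "h holomorphic_on unit_disc" and z: "z \<in> unit_disc" and w: "w \<in> unit_disc"
    and freq: "\<exists>\<^sub>F x in at z. h x = 0"
  shows "h w = 0"
proof (rule analytic_continuation[OF h open_ball connected_ball _ z _ _ w])
  have "z islimpt {x. h x = 0}" using freq by (simp add: islimpt_conv_frequently_at)
  thus "z islimpt ({x. h x = 0} \<inter> unit_disc)"
    by (intro islimpt_Int_eventually eventually_at_in_open') (use z in auto)
qed auto

text \<open>Dividing the defining series by \<open>z ^ (p + 1)\<close> leaves a power series
  \<open>S\<close> that converges on the whole disc, and \<open>k = 1 + z * S\<close>.\<close>

lemma class_A_factor: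
  assumes "f \<in> class_A p"
  obtains k where "k holomorphic_on unit_disc" "k 0 = 1" "\<And>z. z \<in> unit_disc \<Longrightarrow> f z = z ^ p * k z"
proof -
  obtain a where a: "\<And>z. z \<in> unit_disc \<Longrightarrow> (\<lambda>n. a n * z ^ (p + 1 + n)) sums (f z - z ^ p)"
    using assms unfolding class_A_def by blast
  define S where "S z = (\<Sum>n. a n * z ^ n)" for z
  have S: "(\<lambda>n. a n * z ^ n) sums S z" if z: "z \<in> unit_disc" for z
  proof (cases "z = 0")
    case False
    have "summable (\<lambda>n. a n * z ^ (p + 1 + n) * inverse (z ^ (p + 1)))"
      using a[OF z] by (intro summable_mult2) (auto simp: sums_iff)
    also have "(\<lambda>n. a n * z ^ (p + 1 + n) * inverse (z ^ (p + 1))) = (\<lambda>n. a n * z ^ n)"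
      using False by (auto simp: power_add field_simps)
    finally show ?thesis unfolding S_def by (rule summable_sums)
  qed (simp add: S_def powser_sums_zero summable_sums)
  have "S holomorphic_on unit_disc"
    by (rule power_series_holomorphic[of 0 1 a]) (use S in auto)
  moreover have "f z = z ^ p * (1 + z * S z)" if z: "z \<in> unit_disc" for z
  proof -
    have "(\<lambda>n. z ^ (p + 1) * (a n * z ^ n)) sums (z ^ (p + 1) * S z)"
      by (rule sums_mult[OF S[OF z]])
    also have "(\<lambda>n. z ^ (p + 1) * (a n * z ^ n)) = (\<lambda>n. a n * z ^ (p + 1 + n))"
      by (auto simp: power_add)
    finally show ?thesis using sums_unique2[OF a[OF z]] by (simp add: algebra_simps)
  qed
  ultimately show ?thesis
    by (intro that[of "\<lambda>z. 1 + z * S z"]) (auto intro!: holomorphic_intros)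
qed

lemma power_branch_F_op:
  "f \<in> class_A0 p \<eta> \<mu> \<Longrightarrow> power_branch p \<eta> \<mu> f (F_op p \<eta> \<mu> f)"
  using someI_ex[of "power_branch p \<eta> \<mu> f"] by (simp add: class_A0_def F_op_def)

text \<open>
  With \<open>f = z\<^sup>p k\<close> and \<open>f' = p z\<^bsup>p-1\<^esup> B\<close>, the branch is \<open>F = B\<^sup>\<eta> k\<^bsup>-\<mu>\<^esup>\<close> near 0. Multiplied by \<open>B k\<close>, the
  formula for \<open>F' / F\<close> is an identity between holomorphic functions and continues to the disc,
  past the zeros of \<open>B\<close> and \<open>k\<close>.
\<close>

lemma Psi_eq:
  assumes p: "p \<ge> 1" and f: "f \<in> class_A0 p \<eta> \<mu>" and z0: "z0 \<in> unit_disc"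
  defines "F \<equiv> F_op p \<eta> \<mu> f"
  shows "Psi p \<eta> \<mu> \<sigma> \<gamma> f z0 = \<sigma> * F z0 + \<gamma> * (z0 * deriv F z0)"
proof -
  have "power_branch p \<eta> \<mu> f F"
    unfolding F_def by (rule power_branch_F_op[OF f])
  hence F: "F holomorphic_on unit_disc"
    and Fev: "\<forall>\<^sub>F z in at 0. F z =
        (deriv f z / (of_nat p * z ^ (p - 1))) powr \<eta> * (z ^ p / f z) powr \<mu>"
    by (auto simp: power_branch_def)
  obtain k where k: "k holomorphic_on unit_disc" "k 0 = 1"
    and fk: "\<And>z. z \<in> unit_disc \<Longrightarrow> f z = z ^ p * k z"
    using class_A_factor f unfolding class_A0_def by blast
  obtain n where pn: "p = Suc n" using p by (cases p) auto
  define B where "B z = k z + z * deriv k z / of_nat p" for z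
  have k': "deriv k holomorphic_on unit_disc" by (rule holomorphic_deriv[OF k(1) open_ball])
  have B: "B holomorphic_on unit_disc" "B 0 = 1"
    unfolding B_def using pn by (auto intro!: holomorphic_intros k k' simp: k)
  have B': "deriv B holomorphic_on unit_disc" by (rule holomorphic_deriv[OF B(1) open_ball])
  have df: "deriv f z = of_nat p * z ^ n * B z" if z: "z \<in> unit_disc" for z
  proof -
    have "((\<lambda>z. z ^ p * k z) has_field_derivative
        (of_nat p * z ^ n * k z + deriv k z * z ^ p)) (at z)"
      by (rule DERIV_mult[OF _ holomorphic_derivI[OF k(1) open_ball z]])
        (use DERIV_power[OF DERIV_ident, where n = p and x = z] in \<open>simp add: pn\<close>)
    also have "of_nat p * z ^ n * k z + deriv k z * z ^ p = of_nat p * z ^ n * B z"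
      by (simp add: B_def pn field_simps del: of_nat_Suc)
    finally have "((\<lambda>z. z ^ p * k z) has_field_derivative of_nat p * z ^ n * B z) (at z)" .
    hence "(f has_field_derivative of_nat p * z ^ n * B z) (at z)"
      by (rule has_field_derivative_transform_within_open[of _ _ _ unit_disc]) (use z fk in auto)
    thus ?thesis by (rule DERIV_imp_deriv)
  qed
  \<comment> \<open>The factor \<open>z\<close> absorbs the truncated exponent \<open>n - 1\<close>;
    for \<open>n = 0\<close> that term has coefficient 0.\<close>
  have ddf: "z * deriv (deriv f) z = of_nat p * z ^ n * (of_nat n * B z + z * deriv B z)"
    if z: "z \<in> unit_disc" "z \<noteq> 0" for z
  proof -
    have "((\<lambda>z. of_nat p * z ^ n * B z) has_field_derivative
        of_nat p * (of_nat n * z ^ (n - 1) * B z + z ^ n * deriv B z)) (at z)"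
      by (auto intro!: derivative_eq_intros holomorphic_derivI[OF B(1) open_ball z(1)]
          simp: field_simps simp del: of_nat_Suc)
    hence "(deriv f has_field_derivative
        of_nat p * (of_nat n * z ^ (n - 1) * B z + z ^ n * deriv B z)) (at z)"
      by (rule has_field_derivative_transform_within_open[of _ _ _ unit_disc]) (use z df in auto)
    hence "deriv (deriv f) z = of_nat p * (of_nat n * z ^ (n - 1) * B z + z ^ n * deriv B z)"
      by (rule DERIV_imp_deriv)
    thus ?thesis by (cases n) (auto simp: algebra_simps)
  qed
  have log_deriv: "deriv F z * (B z * k z) = F z * (\<eta> * deriv B z * k z - \<mu> * deriv k z * B z)"
    if z: "z \<in> unit_disc" for z
  proof -
    define J where "J z = deriv F z * (B z * k z) - F z * (\<eta> * deriv B z * k z - \<mu> * deriv k z * B z)" for z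
    have J: "J holomorphic_on unit_disc"
      unfolding J_def by (intro holomorphic_intros F B k B' k' open_ball)
    have "continuous (at 0) k" "continuous (at 0) B"
      using k(1) B(1) by (auto intro!: continuous_on_interior[OF holomorphic_on_imp_continuous_on])
    hence "(k \<longlongrightarrow> 1) (nhds 0)" "(B \<longlongrightarrow> 1) (nhds 0)"
      using k B by (simp_all add: continuous_at tendsto_nhds_iff flip: isCont_def)
    hence "\<forall>\<^sub>F z in nhds 0. Re (k z) > 0" "\<forall>\<^sub>F z in nhds 0. Re (B z) > 0"
      by (auto intro!: order_tendstoD(1)[where y = "1::real"] tendsto_eq_intros)
    moreover have "\<forall>\<^sub>F z in nhds (0::complex). z \<in> unit_disc"
      by (intro eventually_nhds_in_open) auto
    ultimately have "\<forall>\<^sub>F z in nhds 0. z \<noteq> 0 \<longrightarrow> z \<in> unit_disc \<and> Re (k z) > 0 \<and> Re (B z) > 0 \<and> F z =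
        (deriv f z / (of_nat p * z ^ (p - 1))) powr \<eta> * (z ^ p / f z) powr \<mu>"
      using Fev unfolding eventually_at_filter by eventually_elim auto
    then obtain e where e: "e > 0" "\<And>z. norm z < e \<Longrightarrow> z \<noteq> 0 \<Longrightarrow> z \<in> unit_disc"
      "\<And>z. norm z < e \<Longrightarrow> z \<noteq> 0 \<Longrightarrow> Re (k z) > 0" "\<And>z. norm z < e \<Longrightarrow> z \<noteq> 0 \<Longrightarrow> Re (B z) > 0"
      "\<And>z. norm z < e \<Longrightarrow> z \<noteq> 0 \<Longrightarrow> F z =
        (deriv f z / (of_nat p * z ^ (p - 1))) powr \<eta> * (z ^ p / f z) powr \<mu>"
      unfolding eventually_nhds_metric by (auto simp: dist_norm)
    \<comment> \<open>Where \<open>B\<close> and \<open>k\<close> lie in the right half-plane, the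
      principal logarithm is differentiable and turns \<open>inverse (k z)\<close> into
      \<open>- Ln (k z)\<close>.\<close>
    have FLn: "F z = exp (\<eta> * Ln (B z) - \<mu> * Ln (k z))" if z: "norm z < e" "z \<noteq> 0" for z
    proof -
      have nz: "B z \<noteq> 0" "k z \<noteq> 0" using e(3,4)[OF z] by auto
      have "k z \<notin> \<real>\<^sub>\<le>\<^sub>0" using e(3)[OF z] by (auto simp: complex_nonpos_Reals_iff)
      moreover have "deriv f z / (of_nat p * z ^ (p - 1)) = B z" "z ^ p / f z = inverse (k z)"
        using z e(2)[OF z] df fk pn by (auto simp: field_simps simp del: of_nat_Suc)
      ultimately show ?thesis
        unfolding e(5)[OF z] using nz
        by (simp add: powr_def Ln_inverse exp_diff exp_minus divide_inverse)
    qed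
    have J0: "J z = 0" if z: "norm z < e" "z \<noteq> 0" for z
    proof -
      have np: "k z \<notin> \<real>\<^sub>\<le>\<^sub>0" "B z \<notin> \<real>\<^sub>\<le>\<^sub>0"
        using e(3,4)[OF z] by (auto simp: complex_nonpos_Reals_iff)
      have nz: "B z \<noteq> 0" "k z \<noteq> 0" using e(3,4)[OF z] by auto
      have "((\<lambda>z. exp (\<eta> * Ln (B z) - \<mu> * Ln (k z))) has_field_derivative
          F z * (\<eta> * (deriv B z / B z) - \<mu> * (deriv k z / k z))) (at z)"
        unfolding FLn[OF z] using np
        by (auto intro!: derivative_eq_intros holomorphic_derivI[OF k(1) open_ball e(2)[OF z]]
            holomorphic_derivI[OF B(1) open_ball e(2)[OF z]] simp: field_simps)
      hence "(F has_field_derivative F z * (\<eta> * (deriv B z / B z) - \<mu> * (deriv k z / k z))) (at z)"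
        by (rule has_field_derivative_transform_within_open[of _ _ _ "ball 0 e - {0}"])
          (use z FLn in auto)
      thus ?thesis using nz by (simp add: J_def DERIV_imp_deriv field_simps)
    qed
    have "\<forall>\<^sub>F z in at 0. J z = 0"
      unfolding eventually_at using e(1) J0 by (auto simp: dist_norm)
    hence "J z = 0"
      by (intro holomorphic_frequently_zero[OF J _ z]) (auto intro: eventually_frequently)
    thus ?thesis by (simp add: J_def)
  qed
  \<comment> \<open>Both functions are 1 at 0, so their zeros are isolated. Hence the quotients in
    \<open>Psi\<close> are genuine at all points near \<open>z0\<close> other than \<open>z0\<close>
    itself, even if \<open>z0\<close> is a zero of \<open>f\<close> or of its derivative.\<close>
  have nonzero: "\<forall>\<^sub>F z in at z0. B z \<noteq> 0" "\<forall>\<^sub>F z in at z0. k z \<noteq> 0"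
    using holomorphic_frequently_zero[OF B(1) z0, of 0] holomorphic_frequently_zero[OF k(1) z0, of 0] B k
    by (auto simp: frequently_def)
  have "\<forall>\<^sub>F z in at z0. z \<noteq> 0"
    by (rule eventually_neq_at_within)
  moreover have "\<forall>\<^sub>F z in at z0. z \<in> unit_disc"
    by (intro eventually_at_in_open') (use z0 in auto)
  ultimately have ev: "\<forall>\<^sub>F z in at z0. \<sigma> * F z + \<gamma> * (z * deriv F z) =
     F z * (\<sigma> + \<gamma> * (\<eta> * (1 - of_nat p + z * deriv (deriv f) z / deriv f z)
               + \<mu> * (of_nat p - z * deriv f z / f z)))"
    using nonzero
  proof eventually_elim
    case (elim z)
    have 1: "z * deriv (deriv f) z / deriv f z = of_nat n + z * deriv B z / B z"
      using elim df[of z] ddf[of z] pn by (simp add: field_simps del: of_nat_Suc)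
    have 2: "z * deriv f z / f z = of_nat p * B z / k z"
      using elim df[of z] fk[of z] pn by (simp add: field_simps del: of_nat_Suc)
    have 3: "of_nat p * B z = of_nat p * k z + z * deriv k z"
      using pn by (simp add: B_def field_simps del: of_nat_Suc)
    have 4: "of_nat p - z * deriv f z / f z = - (z * deriv k z / k z)"
      unfolding 2 3 using elim by (simp add: field_simps)
    have 5: "1 - of_nat p + z * deriv (deriv f) z / deriv f z = z * deriv B z / B z"
      unfolding 1 by (simp add: pn)
    have 6: "deriv F z = F z * (\<eta> * deriv B z / B z - \<mu> * deriv k z / k z)"
      using log_deriv[of z] elim by (simp add: field_simps)
    show ?case unfolding 4 5 6 by (simp add: divide_inverse algebra_simps)
  qed
  have "(\<lambda>z. \<sigma> * F z + \<gamma> * (z * deriv F z)) holomorphic_on unit_disc"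
    by (intro holomorphic_intros F open_ball)
  hence "isCont (\<lambda>z. \<sigma> * F z + \<gamma> * (z * deriv F z)) z0"
    using z0 by (metis holomorphic_on_imp_continuous_on continuous_on_eq_continuous_at open_ball)
  hence "(\<lambda>z. \<sigma> * F z + \<gamma> * (z * deriv F z)) \<midarrow>z0\<rightarrow> \<sigma> * F z0 + \<gamma> * (z0 * deriv F z0)"
    by (simp add: isCont_def)
  hence "(\<lambda>z. F z * (\<sigma> + \<gamma> * (\<eta> * (1 - of_nat p + z * deriv (deriv f) z / deriv f z)
               + \<mu> * (of_nat p - z * deriv f z / f z)))) \<midarrow>z0\<rightarrow> \<sigma> * F z0 + \<gamma> * (z0 * deriv F z0)"
    by (rule Lim_transform_eventually) (use ev in auto)
  \<comment> \<open>The limit at \<open>z0\<close> is the value of a holomorphic function, and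
    \<open>remove_sings\<close> assigns this limit.\<close>
  thus ?thesis
    unfolding Psi_def F_def[symmetric] by (rule remove_sings_eqI)
qed

section \<open>Subordination of the operator and best dominance\<close>

lemma subordinate_cong:
  assumes "g1 \<prec>\<^sub>U h1" "\<And>z. z \<in> unit_disc \<Longrightarrow> g1 z = g2 z" "\<And>z. z \<in> unit_disc \<Longrightarrow> h1 z = h2 z"
  shows "g2 \<prec>\<^sub>U h2"
proof -
  obtain \<omega> where \<omega>: "\<omega> holomorphic_on unit_disc" "\<omega> ` unit_disc \<subseteq> unit_disc" "\<omega> 0 = 0"
    "\<And>z. z \<in> unit_disc \<Longrightarrow> g1 z = h1 (\<omega> z)"
    using assms(1) unfolding subordinate_def by blast
  have "\<forall>z\<in>unit_disc. g2 z = h2 (\<omega> z)"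
    using \<omega>(2,4) assms(2,3) by (metis image_subset_iff)
  moreover have "g2 holomorphic_on unit_disc" "h2 holomorphic_on unit_disc"
    using assms unfolding subordinate_def by (metis holomorphic_transform)+
  ultimately show ?thesis
    unfolding subordinate_def using \<omega>(1-3) by blast
qed

lemma subordinate_cmult:
  assumes "g \<prec>\<^sub>U h" shows "(\<lambda>z. c * g z) \<prec>\<^sub>U (\<lambda>z. c * h z)"
  using assms unfolding subordinate_def by (fastforce intro!: holomorphic_intros)

theorem theorem3p2:
  fixes p :: nat and \<eta> \<mu> \<sigma> \<gamma> :: complex and q f :: "complex \<Rightarrow> complex"
  assumes "p \<ge> 1"
    and "(\<eta>, \<mu>) \<noteq> (0, 0)"
    and "\<gamma> \<noteq> 0"
    and "q holomorphic_on unit_disc" and "inj_on q unit_disc" and "q 0 = 1"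
    and "\<And>z. z \<in> unit_disc \<Longrightarrow>
           Re (1 + z * deriv (deriv q) z / deriv q z) > max 0 (- Re (\<sigma> / \<gamma>))"
    and "f \<in> class_A0 p \<eta> \<mu>"
    and "Psi p \<eta> \<mu> \<sigma> \<gamma> f \<prec>\<^sub>U (\<lambda>z. \<sigma> * q z + \<gamma> * z * deriv q z)"
  shows "F_op p \<eta> \<mu> f \<prec>\<^sub>U q \<and>
         best_dominant (\<lambda>w w' z. \<sigma> * w + \<gamma> * w') (\<lambda>z. \<sigma> * q z + \<gamma> * z * deriv q z)
           {P. P holomorphic_on unit_disc \<and> P 0 = 1} q"
proof
  let ?h = "\<lambda>z. \<sigma> * q z + \<gamma> * z * deriv q z"
  \<comment> \<open>Dividing by \<gamma> reduces the claim to the case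
    \<open>c = \<sigma> / \<gamma>\<close>. It is shown for every admissible \<open>P\<close>
    because best dominance needs all of them.\<close>
  have dom: "P \<prec>\<^sub>U q" if P: "P holomorphic_on unit_disc" "P 0 = 1"
    and sub: "(\<lambda>z. \<sigma> * P z + \<gamma> * (z * deriv P z)) \<prec>\<^sub>U ?h" for P
  proof (rule convex_differential_subordination[OF assms(4,5,7)])
    show "(\<lambda>z. \<sigma> / \<gamma> * P z + z * deriv P z) \<prec>\<^sub>U (\<lambda>z. \<sigma> / \<gamma> * q z + z * deriv q z)"
      using subordinate_cmult[OF sub, of "inverse \<gamma>"] assms(3) by (simp add: field_simps)
  qed (use P assms(6) in auto)
  note power_branch_F_op[OF assms(8)]
  moreover have "(\<lambda>z. \<sigma> * F_op p \<eta> \<mu> f z + \<gamma> * (z * deriv (F_op p \<eta> \<mu> f) z)) \<prec>\<^sub>U ?h"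
    by (rule subordinate_cong[OF assms(9)]) (simp_all add: Psi_eq[OF assms(1,8)])
  ultimately show "F_op p \<eta> \<mu> f \<prec>\<^sub>U q"
    by (intro dom) (auto simp: power_branch_def)
  \<comment> \<open>The function \<open>q\<close> is itself admissible and satisfies the
    subordination with \<omega> the identity. Hence every dominant \<open>g\<close> has
    \<open>q\<close> subordinate to it.\<close>
  have "?h holomorphic_on unit_disc"
    by (intro holomorphic_intros assms(4) open_ball)
  hence "(\<lambda>z. \<sigma> * q z + \<gamma> * (z * deriv q z)) \<prec>\<^sub>U ?h"
    unfolding subordinate_def by (intro conjI exI[of _ "\<lambda>z. z"]) (auto simp: mult.assoc)
  thus "best_dominant (\<lambda>w w' z. \<sigma> * w + \<gamma> * w') ?h {P. P holomorphic_on unit_disc \<and> P 0 = 1} q"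
    unfolding best_dominant_def dominant_def using dom assms(4-6) by auto
qed

end
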